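(* Let $g:\mathbb{N}\to\mathbb{R}_{\geq 0}$ and $h:\mathbb{N}\to\mathbb{R}_{>0}$ be normalized arithmetic functions. Fix $n\geq 1$ and suppose there exists $\kappa_n>0$ such that $(-1)^m Q_m^g(x)>0$ for all real $x<-\kappa_n$ and all $1\leq m\leq n$. (i) Let $x<-\kappa_n$ and $y$ be real numbers with $y\leq x\,H(n-1)$. Then for all $1\leq m\leq n$ $$(-1)^m P_m^{g,h}(y)\ \geq\ (-1)^m\,\frac{y}{x\,h(m)}\,Q_m^g(x)\ >\ 0.$$ (ii) If, instead of the condition $y\leq x\,H(n-1)$, the real number $y$ satisfies $y<-\kappa_n\,H(n-1)$, then for all $1\leq m\leq n$ $$(-1)^m P_m^{g,h}(y)>0.$$
   Context: $\mathbb{N}=\{1,2,3,\dots\}$. An arithmetic function $f$ on $\mathbb{N}$ is normalized if $f(1)=1$. For a normalized arithmetic function $g$ with non-negative values and a normalized arithmetic function $h$ with positive values, define polynomials by $P_0^{g,h}(z)=1$ and $$P_n^{g,h}(z)=\frac{z}{h(n)}\sum_{k=1}^n g(k)\,P_{n-k}^{g,h}(z),\qquad n\geq 1.$$ Let $Q_n^g(z)$ be the case where $h$ is the constant function $1$, i.e. $Q_0^g(z)=1$ and $Q_n^g(z)=z\sum_{k=1}^n g(k)\,Q_{n-k}^g(z)$ for $n\geq 1$. Put $H(n)=\max\{0,h(k): 1\leq k\leq n\}$ for $n\ge1$ and $H(0)=0$.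
   Formalization: In (i) the strict inequality "> 0" is asserted only for y ≠ 0, since for n = 1 the value y = 0 satisfies y ≤ x H(0) = 0 and makes the middle term 0; for n ≥ 2 one always has y < 0, so nothing else changes. *)

theory Defs
  imports Complex_Main "HOL-Computational_Algebra.Polynomial"
begin

text \<open>Arithmetic functions on $\{1,2,3,\dots\}$ are rendered as functions on \<^typ>\<open>nat\<close> whose
  value at \<open>0\<close> is never used: the recursion below and \<open>H_max\<close> only evaluate them at positive
  arguments.\<close>

definition normalized :: "(nat \<Rightarrow> real) \<Rightarrow> bool" where
  "normalized f \<longleftrightarrow> f 1 = 1"

text \<open>The factor $z / h(n)$ is the polynomial \<open>[:0, 1 / h n:]\<close>.\<close>

fun P_poly :: "(nat \<Rightarrow> real) \<Rightarrow> (nat \<Rightarrow> real) \<Rightarrow> nat \<Rightarrow> real poly" where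
  "P_poly g h n =
     (if n = 0 then 1
      else [:0, 1 / h n:] * (\<Sum>k = 1..n. smult (g k) (P_poly g h (n - k))))"

declare P_poly.simps [simp del]

definition Q_poly :: "(nat \<Rightarrow> real) \<Rightarrow> nat \<Rightarrow> real poly" where
  "Q_poly g = P_poly g (\<lambda>_. 1)"

definition H_max :: "(nat \<Rightarrow> real) \<Rightarrow> nat \<Rightarrow> real" where
  "H_max h n = Max (insert 0 (h ` {1..n}))"

lemma P_poly_0: "P_poly g h 0 = 1"
  by (simp add: P_poly.simps)

lemma poly_P_poly:
  "n \<ge> 1 \<Longrightarrow> poly (P_poly g h n) z = z / h n * (\<Sum>k = 1..n. g k * poly (P_poly g h (n - k)) z)"
  by (subst P_poly.simps) (simp add: poly_sum)

lemma Q_poly_0: "Q_poly g 0 = 1"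
  by (simp add: Q_poly_def P_poly_0)

lemma poly_Q_poly:
  "n \<ge> 1 \<Longrightarrow> poly (Q_poly g n) z = z * (\<Sum>k = 1..n. g k * poly (Q_poly g (n - k)) z)"
  by (simp add: Q_poly_def poly_P_poly)

lemma H_max_0: "H_max h 0 = 0"
  by (simp add: H_max_def)

end

theory Submission
  imports Defs "HOL-Computational_Algebra.Formal_Power_Series"
begin

unbundle fps_syntax

text \<open>With \<open>G = \<Sum> g(k) t^k\<close>, \<open>P = \<Sum> P_m(y) t^m\<close> and \<open>Q = \<Sum> Q_m(x) t^m\<close> the recursions say
  \<open>Q * (1 - x * G) = 1\<close> and that \<open>G * P\<close> has the coefficients \<open>h(m) * P_m(y) / y\<close> for \<open>m \<ge> 1\<close>.
  Hence \<open>P = Q * (P - x * G * P)\<close>, that is,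
  \<open>(x * h(m) / y) * P_m(y) = Q_m(x) + \<Sum>0<j<m. (1 - x * h(j) / y) * P_j(y) * Q_{m-j}(x)\<close>.
  The bound on \<open>y\<close> makes all weights \<open>1 - x * h(j) / y\<close> non-negative, so after multiplication by
  \<open>(-1)^m\<close> the claim follows by induction on \<open>m\<close>. Part (ii) is part (i) with \<open>x = y / H(n-1)\<close>.\<close>

text \<open>\<open>g 0\<close> is an arbitrary junk value. Forcing the constant term to be 0
  restricts the convolutions below to \<open>k \<ge> 1\<close>, as in the recursion.\<close>

definition gen_fps :: "(nat \<Rightarrow> real) \<Rightarrow> real fps" where
  "gen_fps g = Abs_fps (\<lambda>k. if k = 0 then 0 else g k)"

definition P_fps :: "(nat \<Rightarrow> real) \<Rightarrow> (nat \<Rightarrow> real) \<Rightarrow> real \<Rightarrow> real fps" where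
  "P_fps g h z = Abs_fps (\<lambda>m. poly (P_poly g h m) z)"

lemma P_fps_nth [simp]: "P_fps g h z $ m = poly (P_poly g h m) z"
  by (simp add: P_fps_def)

lemma gen_fps_nth_0 [simp]: "gen_fps g $ 0 = 0"
  by (simp add: gen_fps_def)

lemma gen_fps_mult_P_fps_nth:
  "(gen_fps g * P_fps g h z) $ m = (\<Sum>k = 1..m. g k * poly (P_poly g h (m - k)) z)"
proof -
  have "(gen_fps g * P_fps g h z) $ m
      = (\<Sum>k = 0..m. (if k = 0 then 0 else g k) * poly (P_poly g h (m - k)) z)"
    by (simp add: fps_mult_nth gen_fps_def)
  also have "\<dots> = (\<Sum>k = 1..m. g k * poly (P_poly g h (m - k)) z)"
    by (rule sum.mono_neutral_cong_right) auto
  finally show ?thesis .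
qed

text \<open>The recursion solved for its sum. It fails at \<open>m = 0\<close>, where the
  coefficient is 0 but the right side would be \<open>h 0 / z\<close>.\<close>

lemma gen_fps_mult_P_fps_nth_recursion:
  assumes "z \<noteq> 0" "h m \<noteq> 0" "m \<ge> 1"
  shows "(gen_fps g * P_fps g h z) $ m = h m / z * poly (P_poly g h m) z"
  using assms by (simp add: gen_fps_mult_P_fps_nth poly_P_poly[of m])

lemma Q_fps_inverse:
  "P_fps g (\<lambda>_. 1) x * (1 - fps_const x * gen_fps g) = 1"
proof (rule fps_ext)
  fix m
  have "P_fps g (\<lambda>_. 1) x * (1 - fps_const x * gen_fps g)
      = P_fps g (\<lambda>_. 1) x - fps_const x * (gen_fps g * P_fps g (\<lambda>_. 1) x)"
    by (simp add: algebra_simps)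
  then show "(P_fps g (\<lambda>_. 1) x * (1 - fps_const x * gen_fps g)) $ m = (1 :: real fps) $ m"
    by (cases "m = 0") (simp_all add: gen_fps_mult_P_fps_nth P_poly_0 poly_P_poly[of m])
qed

lemma P_poly_eq_Q_poly_convolution:
  fixes g h :: "nat \<Rightarrow> real" and x y :: real
  assumes "y \<noteq> 0" and h: "\<And>k. k \<ge> 1 \<Longrightarrow> h k \<noteq> 0" and m: "m \<ge> 1"
  shows "x * h m / y * poly (P_poly g h m) y
       = poly (Q_poly g m) x
       + (\<Sum>j = 1..<m. (1 - x * h j / y) * poly (P_poly g h j) y * poly (Q_poly g (m - j)) x)"
proof -
  define Q where "Q = P_fps g (\<lambda>_. 1) x"
  define P where "P = P_fps g h y"
  define R where "R = P - fps_const x * (gen_fps g * P)"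
  have R0: "R $ 0 = 1"
    by (simp add: R_def P_def gen_fps_mult_P_fps_nth P_poly_0)
  have R: "R $ j = (1 - x * h j / y) * poly (P_poly g h j) y" if "j \<ge> 1" for j
    using gen_fps_mult_P_fps_nth_recursion[OF \<open>y \<noteq> 0\<close> h that] that
    by (simp add: R_def P_def algebra_simps)
  have Q: "Q $ j = poly (Q_poly g j) x" for j
    by (simp add: Q_def Q_poly_def)
  \<comment> \<open>\<open>R\<close> is \<open>P\<close> times the factor that \<open>Q\<close>
    inverts, so multiplying by \<open>Q\<close> recovers \<open>P\<close>.\<close>
  have "R * Q = (Q * (1 - fps_const x * gen_fps g)) * P"
    by (simp add: R_def algebra_simps)
  then have "P = R * Q"
    by (simp add: Q_def Q_fps_inverse)
  then have "P $ m = (\<Sum>j = 0..m. R $ j * Q $ (m - j))"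
    by (simp add: fps_mult_nth)
  \<comment> \<open>The end terms are split off: \<open>j = 0\<close> yields \<open>Q $ m\<close>,
    and \<open>j = m\<close> yields \<open>R $ m\<close>, whose summand \<open>P $ m\<close> cancels
    against the left side and leaves \<open>x * h m / y\<close> as the factor of
    \<open>P $ m\<close>.\<close>
  also have "{0..m} = insert 0 (insert m {1..<m})"
    using m by auto
  finally have "P $ m = Q $ m + R $ m + (\<Sum>j = 1..<m. R $ j * Q $ (m - j))"
    using m R0 Q[of 0] by (simp add: Q_poly_0)
  also have "(\<Sum>j = 1..<m. R $ j * Q $ (m - j))
      = (\<Sum>j = 1..<m. (1 - x * h j / y) * poly (P_poly g h j) y * poly (Q_poly g (m - j)) x)"
    by (intro sum.cong) (simp_all add: R Q)
  finally show ?thesis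
    using R[OF m] Q[of m] by (simp add: P_def algebra_simps)
qed

lemma H_max_nonneg: "H_max h n \<ge> 0"
  by (simp add: H_max_def)

lemma H_max_ge: "k \<in> {1..n} \<Longrightarrow> h k \<le> H_max h n"
  unfolding H_max_def by (rule Max_ge) auto

text \<open>The points \<open>x\<close> and \<open>y\<close> stay fixed throughout the induction, so
  positivity of the signed \<open>Q\<close>-values is required at the single point \<open>x\<close>.
  Strict negativity of \<open>y\<close> is a separate assumption because for \<open>n = 1\<close>
  the bound only says \<open>y \<le> 0\<close>.\<close>

lemma P_poly_lower_bound:
  fixes g h :: "nat \<Rightarrow> real" and x y :: real
  assumes h: "\<And>k. k \<ge> 1 \<Longrightarrow> h k > 0"
    and Q: "\<And>m. m \<in> {1..n} \<Longrightarrow> (-1) ^ m * poly (Q_poly g m) x > 0"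
    and x: "x < 0" and y: "y < 0" "y \<le> x * H_max h (n - 1)"
    and m: "m \<in> {1..n}"
  shows "(-1) ^ m * (y / (x * h m)) * poly (Q_poly g m) x > 0"
    and "(-1) ^ m * poly (P_poly g h m) y \<ge> (-1) ^ m * (y / (x * h m)) * poly (Q_poly g m) x"
proof -
  have scale: "y / (x * h m) > 0" if "m \<in> {1..n}" for m
    using x y(1) h[of m] that by (simp add: divide_neg_neg mult_neg_pos)
  have pos: "(-1) ^ m * (y / (x * h m)) * poly (Q_poly g m) x > 0" if "m \<in> {1..n}" for m
    using mult_pos_pos[OF scale[OF that] Q[OF that]] by (simp only: ac_simps)
  \<comment> \<open>The convolution stops at \<open>j = m - 1 \<le> n - 1\<close>, which is why the
    maximum up to \<open>n - 1\<close> suffices. Dividing \<open>y \<le> x * h j\<close> by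
    \<open>y < 0\<close> gives \<open>x * h j / y \<le> 1\<close>.\<close>
  have weight: "1 - x * h j / y \<ge> 0" if "j \<in> {1..n - 1}" for j
  proof -
    have "x * H_max h (n - 1) \<le> x * h j"
      using H_max_ge[of j "n - 1" h] that x by (simp add: mult_left_mono_neg)
    with y show ?thesis
      by (simp add: divide_le_eq)
  qed
  have bound: "(-1) ^ m * poly (P_poly g h m) y \<ge> (-1) ^ m * (y / (x * h m)) * poly (Q_poly g m) x"
    if "m \<in> {1..n}" for m
    using that
  proof (induction m rule: less_induct)
    case (less m)
    let ?S = "\<Sum>j = 1..<m. (1 - x * h j / y) * poly (P_poly g h j) y * poly (Q_poly g (m - j)) x"
    have "(-1) ^ m * ?S = (\<Sum>j = 1..<m. (1 - x * h j / y) * ((-1) ^ j * poly (P_poly g h j) y)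
        * ((-1) ^ (m - j) * poly (Q_poly g (m - j)) x))"
      unfolding sum_distrib_left
    proof (rule sum.cong)
      fix j assume "j \<in> {1..<m}"
      then have "(-1 :: real) ^ m = (-1) ^ j * (-1) ^ (m - j)"
        by (simp flip: power_add)
      then show "(-1) ^ m * ((1 - x * h j / y) * poly (P_poly g h j) y * poly (Q_poly g (m - j)) x)
          = (1 - x * h j / y) * ((-1) ^ j * poly (P_poly g h j) y)
            * ((-1) ^ (m - j) * poly (Q_poly g (m - j)) x)"
        by (simp only: ac_simps)
    qed simp
    also have "\<dots> \<ge> 0"
    proof (rule sum_nonneg)
      fix j assume j: "j \<in> {1..<m}"
      have "1 - x * h j / y \<ge> 0"
        using j less.prems by (intro weight) auto
      \<comment> \<open>The induction hypothesis bounds the signed value of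
        \<open>P_poly g h j\<close> below by a quantity that \<open>pos\<close> shows to be
        positive.\<close>
      moreover have "(-1) ^ j * poly (P_poly g h j) y \<ge> 0"
        using j less.prems by (intro order.trans[OF less_imp_le[OF pos] less.IH]) auto
      moreover have "(-1) ^ (m - j) * poly (Q_poly g (m - j)) x \<ge> 0"
        using j less.prems by (intro less_imp_le[OF Q]) auto
      ultimately show "(1 - x * h j / y) * ((-1) ^ j * poly (P_poly g h j) y)
          * ((-1) ^ (m - j) * poly (Q_poly g (m - j)) x) \<ge> 0"
        by (rule mult_nonneg_nonneg[OF mult_nonneg_nonneg])
    qed
    finally have S: "(-1) ^ m * ?S \<ge> 0" .
    have hm: "h m > 0" and "m \<ge> 1"
      using h[of m] less.prems by auto
    have "x * h m / y * poly (P_poly g h m) y = poly (Q_poly g m) x + ?S"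
      using P_poly_eq_Q_poly_convolution[of y h m x g] y(1) h \<open>m \<ge> 1\<close> by (metis less_irrefl)
    then have "poly (P_poly g h m) y = y / (x * h m) * (poly (Q_poly g m) x + ?S)"
      using x y(1) hm by (simp add: divide_simps mult.commute)
    then have "(-1) ^ m * poly (P_poly g h m) y
        = (-1) ^ m * (y / (x * h m)) * poly (Q_poly g m) x + y / (x * h m) * ((-1) ^ m * ?S)"
      by (simp only: distrib_left ac_simps)
    then show ?case
      using mult_nonneg_nonneg[OF less_imp_le[OF scale[OF less.prems]] S] by linarith
  qed
  show "(-1) ^ m * (y / (x * h m)) * poly (Q_poly g m) x > 0"
    and "(-1) ^ m * poly (P_poly g h m) y \<ge> (-1) ^ m * (y / (x * h m)) * poly (Q_poly g m) x"
    using pos bound m by blast+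
qed

(* Part (i) admits n = 1, y = 0 (as H(0) = 0), where both sides of the first inequality vanish and
   the strict inequality fails; hence the proviso y \<noteq> 0 there. For n \<ge> 2 it is automatic, since
   then y \<le> x * H(n-1) \<le> x * h(1) = x < 0. *)
theorem theorem1p4:
  fixes g h :: "nat \<Rightarrow> real" and n :: nat and \<kappa> :: real
  assumes "normalized g" and "\<And>k. k \<ge> 1 \<Longrightarrow> g k \<ge> 0"
    and "normalized h" and "\<And>k. k \<ge> 1 \<Longrightarrow> h k > 0"
    and "n \<ge> 1"
    and "\<kappa> > 0"
    and "\<And>x m. x < - \<kappa> \<Longrightarrow> 1 \<le> m \<Longrightarrow> m \<le> n \<Longrightarrow> (-1) ^ m * poly (Q_poly g m) x > 0"
  shows "(\<forall>x y. x < - \<kappa> \<longrightarrow> y \<le> x * H_max h (n - 1) \<longrightarrow>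
            (\<forall>m\<in>{1..n}.
               (-1) ^ m * poly (P_poly g h m) y
                 \<ge> (-1) ^ m * (y / (x * h m)) * poly (Q_poly g m) x
               \<and> (y \<noteq> 0 \<longrightarrow> (-1) ^ m * (y / (x * h m)) * poly (Q_poly g m) x > 0)))
       \<and> (\<forall>y. y < - \<kappa> * H_max h (n - 1) \<longrightarrow>
            (\<forall>m\<in>{1..n}. (-1) ^ m * poly (P_poly g h m) y > 0))"
proof -
  note h = assms(4)
  have bounds: "(-1) ^ m * (y / (x * h m)) * poly (Q_poly g m) x > 0"
    "(-1) ^ m * poly (P_poly g h m) y \<ge> (-1) ^ m * (y / (x * h m)) * poly (Q_poly g m) x"
    if "x < - \<kappa>" "y < 0" "y \<le> x * H_max h (n - 1)" "m \<in> {1..n}" for x y m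
    using P_poly_lower_bound[of h n g x y m, OF h] assms(6,7) that by auto
  have part1: "(-1) ^ m * poly (P_poly g h m) y
        \<ge> (-1) ^ m * (y / (x * h m)) * poly (Q_poly g m) x
      \<and> (y \<noteq> 0 \<longrightarrow> (-1) ^ m * (y / (x * h m)) * poly (Q_poly g m) x > 0)"
    if "x < - \<kappa>" "y \<le> x * H_max h (n - 1)" "m \<in> {1..n}" for x y m
  proof (cases "y = 0")
    \<comment> \<open>Every \<open>P_poly g h m\<close> with \<open>m \<ge> 1\<close> has the factor
      \<open>z\<close>, so both sides vanish.\<close>
    case True
    then show ?thesis
      using that by (simp add: poly_P_poly)
  next
    case False
    have "x * H_max h (n - 1) \<le> 0"
      using that(1) \<open>\<kappa> > 0\<close> H_max_nonneg[of h "n - 1"] by (intro mult_nonpos_nonneg) auto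
    with False that(2) have "y < 0"
      by linarith
    then show ?thesis
      using bounds[of x y m] that by auto
  qed
  have part2: "(-1) ^ m * poly (P_poly g h m) y > 0"
    if y: "y < - \<kappa> * H_max h (n - 1)" and m: "m \<in> {1..n}" for y m
  proof -
    have "y < 0"
      using y mult_nonneg_nonneg[OF less_imp_le[OF \<open>\<kappa> > 0\<close>] H_max_nonneg[of h "n - 1"]] by simp
    \<comment> \<open>If the maximum is 0, the bound on \<open>y\<close> reads
      \<open>y \<le> 0\<close> and any \<open>x < - \<kappa>\<close> will do. Otherwise the quotient
      gives equality, and it lies below \<open>- \<kappa>\<close> by the hypothesis on
      \<open>y\<close>.\<close>
    have "\<exists>x < - \<kappa>. y \<le> x * H_max h (n - 1)"
    proof (cases "H_max h (n - 1) = 0")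
      case True
      then show ?thesis
        using \<open>y < 0\<close> by (intro exI[of _ "- \<kappa> - 1"]) simp
    next
      case False
      then have "H_max h (n - 1) > 0"
        using H_max_nonneg[of h "n - 1"] by simp
      then show ?thesis
        using y by (intro exI[of _ "y / H_max h (n - 1)"]) (simp add: divide_less_eq)
    qed
    then obtain x where "x < - \<kappa>" "y \<le> x * H_max h (n - 1)"
      by blast
    from bounds[OF this(1) \<open>y < 0\<close> this(2) m] show ?thesis
      by linarith
  qed
  show ?thesis
    using part1 part2 by blast
qed

end
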